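(* Let $\gamma$ be the forward unit speed geodesic in the Funk disc $(\mathbb{D},F_F)$ with initial point $p\in\mathbb{D}$ and forward hitting point $y\in\partial\mathbb{D}$. Then the forward Busemann function of $\gamma$ on $(\mathbb{D},F_F)$ is given, for $x\in\mathbb{D}$, by $$b_\gamma(x)=\ln\frac{1-\langle p,y\rangle}{1-\langle x,y\rangle}.$$
   Context: $\mathbb{D}=\{x\in\mathbb{R}^2:|x|<1\}$, with $|\cdot|$ and $\langle\cdot,\cdot\rangle$ the Euclidean norm and inner product. The Funk metric is $F_F(x,v)=\dfrac{\sqrt{(1-|x|^2)|v|^2+\langle x,v\rangle^2}}{1-|x|^2}+\dfrac{\langle x,v\rangle}{1-|x|^2}$. Its (asymmetric) distance is $d_F(x_1,x_2)=\ln\dfrac{|x_1-a|}{|x_2-a|}$ for $x_1\ne x_2$, where $a$ is the point at which the ray from $x_1$ through $x_2$ meets $\partial\mathbb{D}$, and $d_F(x,x)=0$. The forward unit speed geodesic with initial point $p$ and forward hitting point $y$ is $\gamma(t)=e^{-t}p+(1-e^{-t})y$, $t\in[0,\infty)$. The forward Busemann function is $b_\gamma(x)=\lim_{t\to\infty}\{t-d_F(x,\gamma(t))\}$. *)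

theory Defs
  imports "HOL-Analysis.Analysis"
begin

abbreviation unit_disc :: "(real^2) set" where
  "unit_disc \<equiv> ball 0 1"

definition funk_metric :: "real^2 \<Rightarrow> real^2 \<Rightarrow> real" where
  "funk_metric x v =
     sqrt ((1 - (norm x)\<^sup>2) * (norm v)\<^sup>2 + (x \<bullet> v)\<^sup>2) / (1 - (norm x)\<^sup>2)
     + (x \<bullet> v) / (1 - (norm x)\<^sup>2)"

text \<open>The description below is unique when \<open>x1 \<in> unit_disc\<close> and \<open>x2 \<noteq> x1\<close>;
  other arguments are irrelevant.\<close>

definition ray_exit :: "real^2 \<Rightarrow> real^2 \<Rightarrow> real^2" where
  "ray_exit x1 x2 =
     (THE a. a \<in> frontier unit_disc \<and> (\<exists>s\<ge>0. a = x1 + s *\<^sub>R (x2 - x1)))"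

definition funk_dist :: "real^2 \<Rightarrow> real^2 \<Rightarrow> real" where
  "funk_dist x1 x2 =
     (if x1 = x2 then 0
      else ln (norm (x1 - ray_exit x1 x2) / norm (x2 - ray_exit x1 x2)))"

definition funk_geodesic :: "real^2 \<Rightarrow> real^2 \<Rightarrow> real \<Rightarrow> real^2" where
  "funk_geodesic p y t = exp (- t) *\<^sub>R p + (1 - exp (- t)) *\<^sub>R y"

text \<open>\<open>Lim\<close> is unspecified when the limit does not exist, so existence has to be
  asserted separately.\<close>

definition forward_busemann :: "(real \<Rightarrow> real^2) \<Rightarrow> real^2 \<Rightarrow> real" where
  "forward_busemann \<gamma> x = Lim at_top (\<lambda>t. t - funk_dist x (\<gamma> t))"

text \<open>The following facts tie the explicit curve to \<open>funk_metric\<close> and \<open>funk_dist\<close>: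
  it starts at \<open>p\<close>, converges to \<open>y\<close>, has unit speed and is forward minimizing.\<close>

lemma ray_exit_eqI:
  fixes x z y :: "real^2"
  assumes x: "x \<in> unit_disc" and y: "y \<in> frontier unit_disc"
    and s: "s \<ge> 0" "y = x + s *\<^sub>R (z - x)"
  shows "ray_exit x z = y"
  unfolding ray_exit_def
proof (rule the_equality)
  show "y \<in> frontier unit_disc \<and> (\<exists>s\<ge>0. y = x + s *\<^sub>R (z - x))"
    using y s by blast
next
  fix a assume "a \<in> frontier unit_disc \<and> (\<exists>s\<ge>0. a = x + s *\<^sub>R (z - x))"
  then obtain r where a: "a \<in> frontier unit_disc" and r: "r \<ge> 0" "a = x + r *\<^sub>R (z - x)"
    by blast
  have na: "norm a = 1" and ny: "norm y = 1" and nx: "norm x < 1"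
    using a y x by (auto simp: frontier_ball)
  have aux: "u = w" if "u = x + k *\<^sub>R (z - x)" "w = x + l *\<^sub>R (z - x)"
    "0 \<le> k" "k \<le> l" "norm u = 1" "norm w = 1" for u w k l
  proof (cases "k = l")
    case True then show ?thesis using that by simp
  next
    case False
    then have l: "l > 0" "k < l" using that by auto
    have "(k / l) *\<^sub>R w = (k / l) *\<^sub>R x + k *\<^sub>R (z - x)"
      unfolding that(2) scaleR_add_right using l by simp
    then have "u = (1 - k / l) *\<^sub>R x + (k / l) *\<^sub>R w"
      unfolding that(1) by (simp add: scaleR_diff_left)
    then have "norm u \<le> (1 - k / l) * norm x + k / l * norm w"
      using norm_triangle_ineq[of "(1 - k / l) *\<^sub>R x" "(k / l) *\<^sub>R w"] l that by simp
    moreover have "(1 - k / l) * norm x < (1 - k / l) * 1"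
      using nx l by (intro mult_strict_left_mono) auto
    ultimately show ?thesis using that by simp
  qed
  show "a = y"
    using aux[OF r(2) s(2) r(1)] aux[OF s(2) r(2) s(1)] na ny by (cases "r \<le> s") auto
qed

lemma
  assumes p: "p \<in> unit_disc" and y: "y \<in> frontier unit_disc"
  shows funk_geodesic_0: "funk_geodesic p y 0 = p"
    and funk_geodesic_tendsto: "(funk_geodesic p y \<longlongrightarrow> y) at_top"
    and funk_geodesic_in_disc: "t \<ge> 0 \<Longrightarrow> funk_geodesic p y t \<in> unit_disc"
    and funk_geodesic_derivative:
      "(funk_geodesic p y has_vector_derivative (y - funk_geodesic p y t)) (at t)"
    and funk_geodesic_unit_speed:
      "t \<ge> 0 \<Longrightarrow> funk_metric (funk_geodesic p y t) (y - funk_geodesic p y t) = 1"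
    and funk_dist_funk_geodesic:
      "\<lbrakk>0 \<le> s; s \<le> t\<rbrakk> \<Longrightarrow> funk_dist (funk_geodesic p y s) (funk_geodesic p y t) = t - s"
proof -
  have np: "norm p < 1" and ny: "norm y = 1"
    using p y by (auto simp: frontier_ball)
  show "funk_geodesic p y 0 = p" by (simp add: funk_geodesic_def)
  have "((\<lambda>t::real. exp (- t)) \<longlongrightarrow> 0) at_top"
    using exp_at_bot filterlim_compose filterlim_uminus_at_bot_at_top by blast
  then have "((\<lambda>t. exp (- t) *\<^sub>R p + (1 - exp (- t)) *\<^sub>R y) \<longlongrightarrow> 0 *\<^sub>R p + (1 - 0) *\<^sub>R y) at_top"
    by (intro tendsto_intros)
  then show "(funk_geodesic p y \<longlongrightarrow> y) at_top"
    by (simp add: funk_geodesic_def[abs_def])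
  show disc: "funk_geodesic p y t \<in> unit_disc" if "t \<ge> 0" for t
  proof -
    have "norm (funk_geodesic p y t) \<le> exp (- t) * norm p + (1 - exp (- t)) * norm y"
      using norm_triangle_ineq[of "exp (- t) *\<^sub>R p" "(1 - exp (- t)) *\<^sub>R y"] that
      by (simp add: funk_geodesic_def)
    moreover have "exp (- t) * norm p < exp (- t) * 1"
      using np by (intro mult_strict_left_mono) auto
    ultimately have "norm (funk_geodesic p y t) < 1" unfolding ny mult_1_right by linarith
    then show ?thesis by simp
  qed
  show "(funk_geodesic p y has_vector_derivative (y - funk_geodesic p y t)) (at t)"
    unfolding funk_geodesic_def[abs_def]
    by (auto intro!: derivative_eq_intros simp: algebra_simps)
  show "funk_metric (funk_geodesic p y t) (y - funk_geodesic p y t) = 1" if "t \<ge> 0"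
  proof -
    define x where "x = funk_geodesic p y t"
    have nx: "norm x < 1" using disc[OF that] by (simp add: x_def)
    have r: "(norm x)\<^sup>2 < 1" using nx by (simp add: abs_square_less_1)
    have c: "x \<bullet> y < 1"
      using norm_cauchy_schwarz[of x y] nx ny by simp
    have n2: "(norm (y - x))\<^sup>2 = 1 - 2 * (x \<bullet> y) + (norm x)\<^sup>2"
      using ny by (simp add: power2_norm_eq_inner inner_diff inner_commute norm_eq_1)
    have i: "x \<bullet> (y - x) = x \<bullet> y - (norm x)\<^sup>2"
      by (simp add: power2_norm_eq_inner inner_diff)
    have "(1 - (norm x)\<^sup>2) * (norm (y - x))\<^sup>2 + (x \<bullet> (y - x))\<^sup>2 = (1 - x \<bullet> y)\<^sup>2"
      unfolding n2 i by (simp add: algebra_simps power2_eq_square)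
    then have "funk_metric x (y - x)
        = (1 - x \<bullet> y) / (1 - (norm x)\<^sup>2) + (x \<bullet> y - (norm x)\<^sup>2) / (1 - (norm x)\<^sup>2)"
      unfolding funk_metric_def i using c by simp
    also have "\<dots> = (1 - (norm x)\<^sup>2) / (1 - (norm x)\<^sup>2)"
      by (simp add: add_divide_distrib[symmetric])
    finally show ?thesis using r by (simp add: x_def)
  qed
  show "funk_dist (funk_geodesic p y s) (funk_geodesic p y t) = t - s"
    if st: "0 \<le> s" "s \<le> t"
  proof (cases "s = t")
    case True then show ?thesis by (simp add: funk_dist_def)
  next
    case False
    let ?x = "funk_geodesic p y s" and ?z = "funk_geodesic p y t"
    have d: "funk_geodesic p y u - y = exp (- u) *\<^sub>R (p - y)" for u
      by (simp add: funk_geodesic_def algebra_simps)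
    have py: "p \<noteq> y" using np ny by auto
    have e: "exp (- s) - exp (- t) > 0" using st False by simp
    have zx: "?z - ?x = (exp (- s) - exp (- t)) *\<^sub>R (y - p)"
      by (simp add: funk_geodesic_def algebra_simps)
    have "?x \<noteq> ?z" using zx e py by auto
    have "?x + (exp (- s) / (exp (- s) - exp (- t))) *\<^sub>R (?z - ?x)
        = ?x + exp (- s) *\<^sub>R (y - p)"
      unfolding zx using e by simp
    also have "\<dots> = y" by (simp add: funk_geodesic_def algebra_simps)
    finally have "ray_exit ?x ?z = y"
      using e by (intro ray_exit_eqI[OF disc[OF st(1)] y, of "exp (- s) / (exp (- s) - exp (- t))"]) auto
    then have "funk_dist ?x ?z = ln (exp (- s) / exp (- t))"
      using \<open>?x \<noteq> ?z\<close> py by (simp add: funk_dist_def d)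
    then show ?thesis by (simp add: ln_div)
  qed
qed

end

theory Submission
  imports Defs
begin

text \<open>For fixed \<open>x\<close>, the Funk norm \<open>F(x, -)\<close> is the Minkowski functional of the disc translated by
  \<open>-x\<close>, so the ray from \<open>x\<close> through \<open>z\<close> exits at \<open>x + (z - x) / F(x, z - x)\<close> and the distance is
  \<open>- ln (1 - F(x, z - x))\<close>. Along the geodesic \<open>z - x = (y - x) + e\<^sup>-\<^sup>t (p - y)\<close>, with
  \<open>F(x, y - x) = 1\<close>; hence \<open>exp (t - d(x, \<gamma>(t)))\<close> is a difference quotient, and it converges to the
  derivative of \<open>- F(x, -)\<close> at \<open>y - x\<close> in the direction \<open>p - y\<close>.\<close>

lemma one_minus_norm_power2_pos:
  assumes "x \<in> unit_disc"
  shows "1 - (norm x)\<^sup>2 > 0"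
  using assms by (simp add: abs_square_less_1)

lemma inner_frontier_less_1:
  assumes "x \<in> unit_disc" and "y \<in> frontier unit_disc"
  shows "x \<bullet> y < 1"
  using norm_cauchy_schwarz[of x y] assms by (simp add: frontier_ball)

lemma funk_metric_pos:
  assumes "x \<in> unit_disc" and "v \<noteq> 0"
  shows "funk_metric x v > 0"
proof -
  have A: "1 - (norm x)\<^sup>2 > 0" using assms(1) by (rule one_minus_norm_power2_pos)
  have "sqrt ((x \<bullet> v)\<^sup>2) < sqrt ((1 - (norm x)\<^sup>2) * (norm v)\<^sup>2 + (x \<bullet> v)\<^sup>2)"
    using A assms(2) by (intro real_sqrt_less_mono) simp
  then have "sqrt ((1 - (norm x)\<^sup>2) * (norm v)\<^sup>2 + (x \<bullet> v)\<^sup>2) + x \<bullet> v > 0"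
    by simp
  then show ?thesis
    using A by (simp add: funk_metric_def add_divide_distrib[symmetric])
qed

text \<open>Multiplied by \<open>F\<^sup>2\<close>, the equation
  \<open>(norm (x + (1 / F) *\<^sub>R v))\<^sup>2 = 1\<close> becomes a quadratic in
  \<open>F\<close>; the Funk metric is its positive root.\<close>

lemma norm_add_scaled_funk_metric:
  assumes "x \<in> unit_disc" and "v \<noteq> 0"
  shows "norm (x + (1 / funk_metric x v) *\<^sub>R v) = 1"
proof -
  define A where "A = 1 - (norm x)\<^sup>2"
  define F where "F = funk_metric x v"
  have A: "A > 0" using one_minus_norm_power2_pos[OF assms(1)] by (simp add: A_def)
  have F: "F > 0" using funk_metric_pos[OF assms] by (simp add: F_def)
  \<comment> \<open>Isolating the root and squaring recovers the quadratic, up to the factor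
    \<open>A\<close>.\<close>
  have "A * F - x \<bullet> v = sqrt (A * (norm v)\<^sup>2 + (x \<bullet> v)\<^sup>2)"
    using A by (simp add: F_def funk_metric_def A_def[symmetric] field_simps)
  then have "(A * F - x \<bullet> v)\<^sup>2 = A * (norm v)\<^sup>2 + (x \<bullet> v)\<^sup>2"
    using A by simp
  then have "A * (A * F\<^sup>2 - 2 * (x \<bullet> v) * F - (norm v)\<^sup>2) = 0"
    by (simp add: power2_eq_square algebra_simps)
  then have q: "A * F\<^sup>2 - 2 * (x \<bullet> v) * F - (norm v)\<^sup>2 = 0"
    using A by simp
  have "(norm (x + (1 / F) *\<^sub>R v))\<^sup>2 = (norm x)\<^sup>2 + 2 * (x \<bullet> v) / F + (norm v)\<^sup>2 / F\<^sup>2"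
    unfolding power2_norm_eq_inner using F
    by (simp add: inner_add_left inner_add_right inner_commute power2_eq_square field_simps)
  also have "\<dots> = ((norm x)\<^sup>2 * F\<^sup>2 + 2 * (x \<bullet> v) * F + (norm v)\<^sup>2) / F\<^sup>2"
    using F by (simp add: add_divide_distrib power2_eq_square)
  also have "(norm x)\<^sup>2 * F\<^sup>2 + 2 * (x \<bullet> v) * F + (norm v)\<^sup>2 = F\<^sup>2"
    using q by (simp add: A_def algebra_simps)
  also have "F\<^sup>2 / F\<^sup>2 = 1"
    using F by simp
  finally have "(norm (x + (1 / F) *\<^sub>R v))\<^sup>2 = 1" .
  then show ?thesis by (simp only: F_def norm_eq_1 power2_norm_eq_inner)
qed

text \<open>Otherwise the point of norm 1 at parameter \<open>1 / F\<close> on the ray would lie on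
  the segment from \<open>x\<close> to \<open>z\<close>, hence in the open disc by
  convexity.\<close>

lemma funk_metric_less_1:
  assumes "x \<in> unit_disc" and "z \<in> unit_disc"
  shows "funk_metric x (z - x) < 1"
proof (cases "x = z")
  case True
  then show ?thesis by (simp add: funk_metric_def)
next
  case False
  define F where "F = funk_metric x (z - x)"
  show ?thesis
  proof (rule ccontr)
    assume "\<not> ?thesis"
    then have F: "F \<ge> 1" by (simp add: F_def)
    have "x + (1 / F) *\<^sub>R (z - x) = (1 - 1 / F) *\<^sub>R x + (1 / F) *\<^sub>R z"
      by (simp add: algebra_simps)
    also have "\<dots> \<in> unit_disc"
      using F by (intro convexD[OF convex_ball] assms) auto
    finally show False
      using norm_add_scaled_funk_metric[of x "z - x"] assms(1) False by (simp add: F_def)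
  qed
qed

lemma funk_dist_eq_funk_metric:
  assumes x: "x \<in> unit_disc" and z: "z \<in> unit_disc"
  shows "funk_dist x z = - ln (1 - funk_metric x (z - x))"
proof (cases "x = z")
  case True
  then show ?thesis by (simp add: funk_dist_def funk_metric_def)
next
  case False
  define F where "F = funk_metric x (z - x)"
  define a where "a = x + (1 / F) *\<^sub>R (z - x)"
  have F: "0 < F" "F < 1"
    using funk_metric_pos[of x "z - x"] funk_metric_less_1[OF x z] x False by (auto simp: F_def)
  have "a \<in> frontier unit_disc"
    using norm_add_scaled_funk_metric[of x "z - x"] x False
    by (simp add: a_def F_def frontier_ball)
  then have e: "ray_exit x z = a"
    using F by (intro ray_exit_eqI[OF x, of _ "1 / F"]) (auto simp: a_def)
  \<comment> \<open>Since \<open>1 / F > 1\<close>, the exit point lies beyond \<open>z\<close>,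
    which fixes the signs when norms are taken.\<close>
  have "x - a = (- (1 / F)) *\<^sub>R (z - x)" and "z - a = (1 - 1 / F) *\<^sub>R (z - x)"
    by (simp_all add: a_def algebra_simps)
  then have "norm (x - a) = (1 / F) * norm (z - x)"
    and "norm (z - a) = (1 / F - 1) * norm (z - x)"
    using F by (simp_all add: abs_if)
  then have "norm (x - a) / norm (z - a) = (1 / F) / (1 / F - 1)"
    using False by simp
  also have "\<dots> = 1 / (1 - F)"
    using F by (simp add: field_simps)
  finally show ?thesis
    using F False by (simp add: funk_dist_def e ln_div F_def)
qed

text \<open>At vectors ending on the unit circle the radicand of the Funk metric is a perfect
  square, so the root there is explicit.\<close>

lemma funk_discriminant_frontier:
  assumes "y \<in> frontier unit_disc"
  shows "(1 - (norm x)\<^sup>2) * (norm (y - x))\<^sup>2 + (x \<bullet> (y - x))\<^sup>2 = (1 - x \<bullet> y)\<^sup>2"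
proof -
  have "y \<bullet> y = 1" using assms by (simp add: frontier_ball norm_eq_1)
  then show ?thesis
    unfolding power2_norm_eq_inner
    by (simp add: inner_diff inner_commute power2_eq_square algebra_simps)
qed

lemma funk_metric_frontier:
  assumes "x \<in> unit_disc" and "y \<in> frontier unit_disc"
  shows "funk_metric x (y - x) = 1"
proof -
  have "x \<bullet> (y - x) = x \<bullet> y - (norm x)\<^sup>2"
    by (simp add: power2_norm_eq_inner inner_diff)
  then show ?thesis
    using one_minus_norm_power2_pos[OF assms(1)] inner_frontier_less_1[OF assms]
    unfolding funk_metric_def funk_discriminant_frontier[OF assms(2)]
    by (simp add: add_divide_distrib[symmetric])
qed

text \<open>Geometrically, the level set \<open>F(x, -) = 1\<close> is the translated circle with
  normal \<open>y\<close> at \<open>y - x\<close>; homogeneity fixes the factor, because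
  \<open>y \<bullet> (y - x) = 1 - x \<bullet> y\<close>. The proof differentiates the formula
  instead.\<close>

lemma funk_metric_has_derivative_frontier:
  assumes x: "x \<in> unit_disc" and y: "y \<in> frontier unit_disc"
  shows "((\<lambda>e. funk_metric x ((y - x) + e *\<^sub>R w)) has_field_derivative (y \<bullet> w) / (1 - x \<bullet> y)) (at 0)"
proof -
  define A where "A = 1 - (norm x)\<^sup>2"
  define c where "c = 1 - x \<bullet> y"
  define v where "v = y - x"
  have A: "A > 0" using one_minus_norm_power2_pos[OF x] by (simp add: A_def)
  have c: "c > 0" using inner_frontier_less_1[OF x y] by (simp add: c_def)
  have disc: "A * (v \<bullet> v) + (x \<bullet> v)\<^sup>2 = c\<^sup>2"
    using funk_discriminant_frontier[OF y, of x]
    by (simp add: A_def c_def v_def power2_norm_eq_inner)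
  have xv: "x \<bullet> v = A - c"
    by (simp add: A_def c_def v_def power2_norm_eq_inner inner_diff)
  have vw: "v \<bullet> w = y \<bullet> w - x \<bullet> w"
    by (simp add: v_def inner_diff)
  have F: "funk_metric x (v + e *\<^sub>R w)
      = (sqrt (A * (v \<bullet> v + 2 * e * (v \<bullet> w) + e\<^sup>2 * (w \<bullet> w)) + (x \<bullet> v + e * (x \<bullet> w))\<^sup>2)
         + (x \<bullet> v + e * (x \<bullet> w))) / A" for e
    unfolding funk_metric_def A_def[symmetric] power2_norm_eq_inner[of "v + e *\<^sub>R w"]
    by (simp add: add_divide_distrib inner_add_left inner_add_right inner_commute
        power2_eq_square algebra_simps)
  \<comment> \<open>At \<open>e = 0\<close> the radicand is \<open>c\<^sup>2\<close> with
    \<open>c > 0\<close>, so the root is differentiable and contributes the denominator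
    \<open>2 * c\<close>.\<close>
  have "((\<lambda>e. funk_metric x (v + e *\<^sub>R w)) has_field_derivative
      ((A * (2 * (v \<bullet> w)) + 2 * (x \<bullet> v) * (x \<bullet> w)) / (2 * c) + x \<bullet> w) / A) (at 0)"
    unfolding F using A c disc
    by (auto intro!: derivative_eq_intros simp: field_simps)
  \<comment> \<open>After substituting \<open>xv\<close> and \<open>vw\<close>, all terms in
    \<open>x \<bullet> w\<close> cancel.\<close>
  also have "((A * (2 * (v \<bullet> w)) + 2 * (x \<bullet> v) * (x \<bullet> w)) / (2 * c) + x \<bullet> w) / A = (y \<bullet> w) / c"
    using A c unfolding xv vw by (simp add: field_simps)
  finally show ?thesis by (simp add: v_def c_def)
qed

lemma tendsto_minus_funk_dist_geodesic:
  assumes p: "p \<in> unit_disc" and y: "y \<in> frontier unit_disc" and x: "x \<in> unit_disc"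
  shows "((\<lambda>t. t - funk_dist x (funk_geodesic p y t)) \<longlongrightarrow> ln ((1 - p \<bullet> y) / (1 - x \<bullet> y))) at_top"
proof -
  define h where "h = (\<lambda>e. funk_metric x ((y - x) + e *\<^sub>R (p - y)))"
  have h0: "h 0 = 1"
    using funk_metric_frontier[OF x y] by (simp add: h_def)
  have "y \<bullet> y = 1"
    using y by (simp add: frontier_ball norm_eq_1)
  then have "(h has_field_derivative (p \<bullet> y - 1) / (1 - x \<bullet> y)) (at 0)"
    using funk_metric_has_derivative_frontier[OF x y, of "p - y"]
    by (simp add: h_def inner_diff inner_commute)
  then have "((\<lambda>e. (h e - 1) / e) \<longlongrightarrow> (p \<bullet> y - 1) / (1 - x \<bullet> y)) (at 0)"
    by (simp add: has_field_derivative_iff h0)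
  then have lim: "((\<lambda>e. - ((h e - 1) / e)) \<longlongrightarrow> - ((p \<bullet> y - 1) / (1 - x \<bullet> y))) (at 0)"
    by (rule tendsto_minus)
  have "((\<lambda>t::real. exp (- t)) \<longlongrightarrow> 0) at_top"
    using exp_at_bot filterlim_compose filterlim_uminus_at_bot_at_top by blast
  \<comment> \<open>The difference quotient converges along the punctured filter
    \<open>at 0\<close>; \<open>exp (- t)\<close> never vanishes, so composition is allowed.\<close>
  then have "filterlim (\<lambda>t::real. exp (- t)) (at 0) at_top"
    by (simp add: filterlim_at)
  from filterlim_compose[OF lim this]
  have "((\<lambda>t. (1 - h (exp (- t))) / exp (- t)) \<longlongrightarrow> (1 - p \<bullet> y) / (1 - x \<bullet> y)) at_top"
    by (simp add: minus_divide_left)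
  \<comment> \<open>A nonzero limit is what lets \<open>ln\<close> pass through it.\<close>
  moreover have "(1 - p \<bullet> y) / (1 - x \<bullet> y) > 0"
    using inner_frontier_less_1[OF p y] inner_frontier_less_1[OF x y] by simp
  ultimately have L: "((\<lambda>t. ln ((1 - h (exp (- t))) / exp (- t)))
      \<longlongrightarrow> ln ((1 - p \<bullet> y) / (1 - x \<bullet> y))) at_top"
    by (intro tendsto_ln) auto
  \<comment> \<open>Dividing by \<open>exp (- t)\<close> inside the logarithm produces the summand
    \<open>t\<close>.\<close>
  have "\<forall>\<^sub>F t in at_top. ln ((1 - h (exp (- t))) / exp (- t))
      = t - funk_dist x (funk_geodesic p y t)"
    using eventually_ge_at_top[of 0]
  proof eventually_elim
    case (elim t)
    have z: "funk_geodesic p y t \<in> unit_disc"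
      using funk_geodesic_in_disc[OF p y elim] .
    have "(y - x) + exp (- t) *\<^sub>R (p - y) = funk_geodesic p y t - x"
      by (simp add: funk_geodesic_def algebra_simps)
    then have "h (exp (- t)) = funk_metric x (funk_geodesic p y t - x)"
      by (simp only: h_def)
    then show ?case
      using funk_dist_eq_funk_metric[OF x z] funk_metric_less_1[OF x z] by (simp add: ln_div)
  qed
  with L show ?thesis by (rule Lim_transform_eventually)
qed

theorem theorem6p1:
  fixes p y x :: "real^2"
  assumes "p \<in> unit_disc" and "y \<in> frontier unit_disc" and "x \<in> unit_disc"
  shows "((\<lambda>t. t - funk_dist x (funk_geodesic p y t))
            \<longlongrightarrow> forward_busemann (funk_geodesic p y) x) at_top
       \<and> forward_busemann (funk_geodesic p y) x = ln ((1 - p \<bullet> y) / (1 - x \<bullet> y))"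
proof -
  note lim = tendsto_minus_funk_dist_geodesic[OF assms]
  \<comment> \<open>Convergence identifies the value of \<open>Lim\<close>, and so also yields the
    first conjunct.\<close>
  then have "forward_busemann (funk_geodesic p y) x = ln ((1 - p \<bullet> y) / (1 - x \<bullet> y))"
    unfolding forward_busemann_def by (intro tendsto_Lim) auto
  with lim show ?thesis by simp
qed

end
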